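(* Let $G$ be a graph with $n$ vertices, adjacency matrix $A$, and distinct adjacency eigenvalues $\theta_0 > \theta_1 > \cdots > \theta_d$ with $d \geq 2$. Let $\Delta$ be the maximum degree of $G$, and let $\theta_i$ be the largest eigenvalue such that $\theta_i \leq -\frac{\Delta}{\theta_0}$. Then \[ \chi_2(G) \geq \frac{(\theta_0 - \theta_i)(\theta_0 - \theta_{i-1})}{\Delta + \theta_i\theta_{i-1}}. \] Moreover, this is the best possible bound obtainable from the general Ratio-type bound with $t = 2$; that is, writing $\lambda_1 \ge \cdots \ge \lambda_n$ for the eigenvalues of $A$ with multiplicity, for every $p \in \mathbb{R}_2[x]$ with $p(\lambda_1) > \lambda(p)$ one has \[ \frac{p(\lambda_1) - \lambda(p)}{W(p) - \lambda(p)} \le \frac{(\theta_0 - \theta_i)(\theta_0 - \theta_{i-1})}{\Delta + \theta_i\theta_{i-1}}, \] where $W(p) := \max_{u \in V}\{(p(A))_{uu}\}$ and $\lambda(p) := \min_{j \in [2,n]}\{p(\lambda_j)\}$.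
   Context: Graphs are finite and simple. $\mathbb{R}_2[x]$ is the set of real polynomials of degree at most $2$. $\chi_2(G)$ is the distance-$2$ chromatic number: the minimum number of colors in a vertex coloring in which any two distinct vertices at distance at most $2$ get distinct colors. The general Ratio-type bound (a known result) states that for every $p \in \mathbb{R}_t[x]$ with $p(\lambda_1) > \lambda(p)$, $\chi_t(G) \ge \frac{p(\lambda_1) - \lambda(p)}{W(p) - \lambda(p)}$. *)

theory Defs
  imports
    "Graph_Theory.Graph_Theory"
    "Jordan_Normal_Form.Char_Poly"
begin

text \<open>
  A finite simple graph is a \<^term>\<open>pair_graph\<close>: a finite loop-free digraph whose arcs are vertex
  pairs forming a symmetric relation, an edge being a pair of opposite arcs. Hence the degree of a
  vertex is its out-degree, and distances are taken along directed walks.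
\<close>

definition max_degree :: "'a pair_pre_digraph \<Rightarrow> nat" where
  "max_degree G = Max (out_degree (with_proj G) ` pverts G)"

text \<open>Unweighted distance; it is infinite between different components.\<close>

definition graph_dist :: "'a pair_pre_digraph \<Rightarrow> 'a \<Rightarrow> 'a \<Rightarrow> ereal" where
  "graph_dist G u v = wf_digraph.\<mu> (with_proj G) (\<lambda>_. 1) u v"

definition distance_coloring :: "nat \<Rightarrow> 'a pair_pre_digraph \<Rightarrow> ('a \<Rightarrow> nat) \<Rightarrow> bool" where
  "distance_coloring t G c \<longleftrightarrow>
     (\<forall>u\<in>pverts G. \<forall>v\<in>pverts G. u \<noteq> v \<and> graph_dist G u v \<le> ereal (real t) \<longrightarrow> c u \<noteq> c v)"

definition distance_chromatic_number :: "nat \<Rightarrow> 'a pair_pre_digraph \<Rightarrow> nat" where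
  "distance_chromatic_number t G =
     (LEAST k. \<exists>c. distance_coloring t G c \<and> card (c ` pverts G) = k)"

text \<open>
  The rows and columns are indexed by \<open>0, \<dots>, n - 1\<close>; \<open>v\<close> enumerates the vertices.
\<close>

definition adjacency_matrix :: "nat \<Rightarrow> (nat \<Rightarrow> 'a) \<Rightarrow> 'a pair_pre_digraph \<Rightarrow> real mat" where
  "adjacency_matrix n v G = mat n n (\<lambda>(i, j). if (v i, v j) \<in> parcs G then 1 else 0)"

text \<open>
  \<open>eigval_desc A j\<close> is the \<open>j\<close>-th largest eigenvalue of \<open>A\<close>, for \<open>1 \<le> j \<le> dim_row A\<close>, counted with
  multiplicity as a root of the characteristic polynomial. It is used for real symmetric \<open>A\<close> only,
  whose characteristic polynomial has \<open>dim_row A\<close> real roots.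
\<close>

definition eigval_desc :: "real mat \<Rightarrow> nat \<Rightarrow> real" where
  "eigval_desc A j = rev (sorted_list_of_multiset (proots (char_poly A))) ! (j - 1)"

definition poly_mat :: "real poly \<Rightarrow> real mat \<Rightarrow> real mat" where
  "poly_mat p A = mat (dim_row A) (dim_row A)
     (\<lambda>(i, j). \<Sum>k\<le>degree p. coeff p k * (A ^\<^sub>m k) $$ (i, j))"

text \<open>The quantities $W(p)$ and $\lambda(p)$ of the Ratio-type bound.\<close>

definition ratio_W :: "real mat \<Rightarrow> real poly \<Rightarrow> real" where
  "ratio_W A p = Max ((\<lambda>u. poly_mat p A $$ (u, u)) ` {..<dim_row A})"

definition ratio_lambda :: "real mat \<Rightarrow> real poly \<Rightarrow> real" where
  "ratio_lambda A p = Min ((\<lambda>j. poly p (eigval_desc A j)) ` {2..dim_row A})"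

end

theory Submission
  imports Defs "Jordan_Normal_Form.Schur_Decomposition"
begin

text \<open>
  Write $q(x) = (x - \theta_i)(x - \theta_{i-1})$. The two roots are consecutive eigenvalues, so $q$ is
  nonnegative on the spectrum and $q(A)$ is positive semidefinite; its diagonal entries are at most
  $\Delta + \theta_i\theta_{i-1}$, and its entries between distinct vertices of the same colour vanish.
  Splitting an eigenvector for $\theta_0$ along the colour classes, Cauchy--Schwarz for the form $q(A)$
  gives $q(\theta_0) \le \chi_2(G)\,(\Delta + \theta_i\theta_{i-1})$.

  For optimality, look at the diagonal entry of $p(A)$ at a vertex of maximum degree: it is the value at
  $p$ of the functional $x^2 \mapsto \Delta$, $x \mapsto 0$, $1 \mapsto 1$. The choice of $i$ makes
  this functional a nonnegative combination of the evaluations at $\theta_0$, $\theta_{i-1}$,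
  $\theta_i$, in which $\theta_0$ has weight $(\Delta + \theta_i\theta_{i-1}) / q(\theta_0)$.
  Applied to $p - \lambda(p)$ this is the claim.
\<close>

section \<open>The spectral theorem for real symmetric matrices\<close>

text \<open>A complex root \<open>z\<close> of the characteristic polynomial exists by the
  fundamental theorem of algebra. For an eigenvector \<open>w\<close>, the Hermitian form of
  \<open>A\<close> at \<open>w\<close> is \<open>z\<close> times the squared norm of
  \<open>w\<close> and is its own conjugate, so \<open>z\<close> is real.\<close>

lemma symmetric_mat_real_eigenvalue:
  fixes A :: "real mat"
  assumes A: "A \<in> carrier_mat n n" and sym: "transpose_mat A = A" and n: "n > 0"
  shows "\<exists>e. eigenvalue A e"
proof -
  define C where "C = map_mat complex_of_real A"
  have C: "C \<in> carrier_mat n n" using A by (simp add: C_def)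
  have cpC: "char_poly C = map_poly complex_of_real (char_poly A)"
    unfolding C_def by (rule of_real_hom.char_poly_hom[OF A])
  have "degree (char_poly C) = n" using degree_monic_char_poly[OF C] by simp
  with n have "\<not> constant (poly (char_poly C))" by (simp add: constant_degree)
  then obtain z where z: "poly (char_poly C) z = 0"
    using fundamental_theorem_of_algebra by blast
  then have "eigenvalue C z" using eigenvalue_root_char_poly[OF C] by simp
  then obtain w where w: "w \<in> carrier_vec n" "w \<noteq> 0\<^sub>v n" and Cw: "C *\<^sub>v w = z \<cdot>\<^sub>v w"
    using C unfolding eigenvalue_def eigenvector_def by auto
  define N where "N = (\<Sum>a<n. (cmod (w $ a))\<^sup>2)"
  define S where "S = (\<Sum>a<n. \<Sum>b<n. of_real (A $$ (a,b)) * w $ b * cnj (w $ a))"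
  have Npos: "N > 0"
  proof -
    obtain a where "a < n" "w $ a \<noteq> 0" using w by (metis carrier_vecD eq_vecI index_zero_vec)
    then show ?thesis unfolding N_def by (intro sum_pos2[of _ a]) auto
  qed
  have row: "(\<Sum>b<n. of_real (A $$ (a,b)) * w $ b) = z * w $ a" if "a < n" for a
  proof -
    have "(C *\<^sub>v w) $ a = (z \<cdot>\<^sub>v w) $ a" by (simp add: Cw)
    then show ?thesis using that A w
      by (simp add: C_def scalar_prod_def atLeast0LessThan)
  qed
  have "S = (\<Sum>a<n. (\<Sum>b<n. of_real (A $$ (a,b)) * w $ b) * cnj (w $ a))"
    by (simp add: S_def sum_distrib_right)
  also have "\<dots> = (\<Sum>a<n. z * of_real ((cmod (w $ a))\<^sup>2))"
    by (intro sum.cong) (auto simp: row mult.assoc complex_norm_square[symmetric] simp del: of_real_power)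
  finally have SN: "S = z * of_real N" by (simp add: N_def sum_distrib_left)
  have symA: "A $$ (a,b) = A $$ (b,a)" if "a < n" "b < n" for a b
    using that A sym by (metis carrier_matD index_transpose_mat(1))
  \<comment> \<open>Conjugation exchanges the roles of the two indices, and the symmetry of the real
    matrix \<open>A\<close> undoes this.\<close>
  have "cnj S = (\<Sum>a<n. \<Sum>b<n. of_real (A $$ (a,b)) * cnj (w $ b) * w $ a)"
    by (simp add: S_def)
  also have "\<dots> = (\<Sum>b<n. \<Sum>a<n. of_real (A $$ (a,b)) * cnj (w $ b) * w $ a)"
    by (rule sum.swap)
  also have "\<dots> = S" unfolding S_def
    by (intro sum.cong refl) (auto simp: symA mult_ac)
  finally have "cnj z = z" using SN Npos by simp
  then have "z = of_real (Re z)" by (metis complex_cnj_cancel_iff Reals_cnj_iff of_real_Re)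
  then have "poly (map_poly complex_of_real (char_poly A)) (of_real (Re z)) = 0"
    using z cpC by simp
  then have "poly (char_poly A) (Re z) = 0" by (simp add: of_real_hom.poly_map_poly)
  then show ?thesis using eigenvalue_root_char_poly[OF A] by blast
qed

text \<open>Gram-Schmidt leaves the first vector of its input unchanged, so it is applied to a
  completion of \<open>v\<close> to a basis; \<open>c\<close> is the factor that normalises
  \<open>v\<close>.\<close>

lemma orthogonal_mat_with_first_col:
  fixes v :: "real vec"
  assumes v: "v \<in> carrier_vec n" and v0: "v \<noteq> 0\<^sub>v n"
  shows "\<exists>W c. W \<in> carrier_mat n n \<and> transpose_mat W * W = 1\<^sub>m n \<and> col W 0 = c \<cdot>\<^sub>v v"
proof -
  have n: "n > 0" using v v0 by (metis carrier_vecD eq_vecI gr0I index_zero_vec(2) less_zeroE)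
  interpret cof_vec_space n "TYPE(real)" .
  define ws where "ws = gram_schmidt n (basis_completion v)"
  note bc = basis_completion[OF v v0]
  from bc n obtain vs where bv: "basis_completion v = v # vs" 
    by (cases "basis_completion v") auto
  note gs = gram_schmidt_result[OF bc(2) bc(4) bc(5) refl, folded ws_def]
  have ws: "set ws \<subseteq> carrier_vec n" "corthogonal ws" "length ws = n"
    using gs bc by auto
  have hd: "ws ! 0 = v"
    using gram_schmidt_hd[OF v, of vs] n ws by (metis bv hd_conv_nth length_greater_0_conv ws_def)
  have wsc: "ws ! i \<in> carrier_vec n" if "i < n" for i using ws that by auto
  have orth: "(ws ! i \<bullet> ws ! j = 0) = (i \<noteq> j)" if "i < n" "j < n" for i j
  proof -
    \<comment> \<open>Over the reals conjugation is the identity, so \<open>corthogonal\<close>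
      means ordinary orthogonality.\<close>
    have c: "conjugate (u :: real vec) = u" for u by (rule eq_vecI) auto
    show ?thesis using corthogonalD[OF ws(2)] that ws(3) by (metis c)
  qed
  define r where "r i = 1 / sqrt (ws ! i \<bullet> ws ! i)" for i
  have r: "r i * r i * (ws ! i \<bullet> ws ! i) = 1" if "i < n" for i
  proof -
    have "ws ! i \<bullet> ws ! i \<ge> 0" by (simp add: scalar_prod_def sum_nonneg)
    then show ?thesis using orth[OF that that] by (simp add: r_def)
  qed
  define W where "W = mat_of_cols n (map (\<lambda>i. r i \<cdot>\<^sub>v ws ! i) [0..<n])"
  have W: "W \<in> carrier_mat n n" by (auto simp: W_def intro!: carrier_matI)
  have colW: "col W i = r i \<cdot>\<^sub>v ws ! i" if "i < n" for i
    using that wsc[OF that] by (simp add: W_def)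
  have "transpose_mat W * W = 1\<^sub>m n"
  proof (rule eq_matI)
    fix i j assume "i < dim_row (1\<^sub>m n :: real mat)" "j < dim_col (1\<^sub>m n :: real mat)"
    then have ij: "i < n" "j < n" by auto
    have "(transpose_mat W * W) $$ (i,j) = col W i \<bullet> col W j" using W ij by simp
    also have "\<dots> = r i * r j * (ws ! i \<bullet> ws ! j)"
      using wsc[OF ij(1)] wsc[OF ij(2)] by (simp add: colW ij)
    also have "\<dots> = 1\<^sub>m n $$ (i,j)" using ij orth[OF ij] r by auto
    finally show "(transpose_mat W * W) $$ (i,j) = 1\<^sub>m n $$ (i,j)" .
  qed (use W in auto)
  then show ?thesis using W colW[OF n] hd by metis
qed

text \<open>Deflation: in an orthonormal basis that starts with an eigenvector, the first column
  vanishes off the diagonal, and by symmetry so does the first row. The induction hypothesis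
  diagonalises the remaining block.\<close>

lemma symmetric_mat_orthogonally_diagonalizable:
  fixes A :: "real mat"
  assumes "A \<in> carrier_mat n n" and "transpose_mat A = A"
  shows "\<exists>U D. U \<in> carrier_mat n n \<and> D \<in> carrier_mat n n \<and> transpose_mat U * U = 1\<^sub>m n
    \<and> diagonal_mat D \<and> A = U * D * transpose_mat U"
  using assms
proof (induction n arbitrary: A)
  case 0
  then show ?case by (intro exI[of _ "1\<^sub>m 0"]) (auto simp: diagonal_mat_def)
next
  case (Suc n A)
  note A = Suc.prems(1) and sym = Suc.prems(2)
  obtain e v where "eigenvector A v e"
    using symmetric_mat_real_eigenvalue[OF A sym] unfolding eigenvalue_def by auto
  then have v: "v \<in> carrier_vec (Suc n)" "v \<noteq> 0\<^sub>v (Suc n)" and Av: "A *\<^sub>v v = e \<cdot>\<^sub>v v"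
    using A unfolding eigenvector_def by auto
  obtain W c where W: "W \<in> carrier_mat (Suc n) (Suc n)" and WW: "transpose_mat W * W = 1\<^sub>m (Suc n)"
    and W0: "col W 0 = c \<cdot>\<^sub>v v"
    using orthogonal_mat_with_first_col[OF v] by blast
  have WT: "transpose_mat W \<in> carrier_mat (Suc n) (Suc n)" using W by simp
  have WW': "W * transpose_mat W = 1\<^sub>m (Suc n)"
    by (rule mat_mult_left_right_inverse[OF WT W WW])
  let ?C = "carrier_mat (Suc n) (Suc n) :: real mat set"
  have mult: "X * Y \<in> ?C" if "X \<in> ?C" "Y \<in> ?C" for X Y using that by simp
  have assoc: "X * Y * Z = X * (Y * Z)" if "X \<in> ?C" "Y \<in> ?C" "Z \<in> ?C" for X Y Z
    using that by simp
  define B where "B = transpose_mat W * A * W"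
  have B: "B \<in> carrier_mat (Suc n) (Suc n)" using W A by (simp add: B_def)
  have symB: "transpose_mat B = B"
    unfolding B_def transpose_mult[OF mult_carrier_mat[OF WT A] W] transpose_mult[OF WT A]
    using W A WT sym by simp
  have AB: "A = W * B * transpose_mat W"
  proof -
    have "W * B * transpose_mat W = (W * transpose_mat W) * A * (W * transpose_mat W)"
      using W WT A by (simp add: B_def assoc mult del: assoc_mult_mat)
    then show ?thesis using A WW' by simp
  qed
  have col0: "B $$ (i,0) = (if i = 0 then e else 0)" if i: "i < Suc n" for i
  proof -
    have "col (A * W) 0 = A *\<^sub>v (c \<cdot>\<^sub>v v)"
      using A W v W0 by (intro eq_vecI) auto
    also have "\<dots> = e \<cdot>\<^sub>v col W 0"
      using A v Av by (simp add: W0 mult_mat_vec smult_smult_assoc mult.commute)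
    finally have AW: "col (A * W) 0 = e \<cdot>\<^sub>v col W 0" .
    have "B = transpose_mat W * (A * W)" using W A by (simp add: B_def)
    then have "B $$ (i,0) = col W i \<bullet> col (A * W) 0" using W A i by simp
    also have "\<dots> = e * (col W i \<bullet> col W 0)" using W by (simp add: AW)
    also have "col W i \<bullet> col W 0 = (transpose_mat W * W) $$ (i,0)" using W i by simp
    finally show ?thesis using i by (simp add: WW)
  qed
  define A' where "A' = mat n n (\<lambda>(i,j). B $$ (Suc i, Suc j))"
  have symB': "B $$ (i,j) = B $$ (j,i)" if "i < Suc n" "j < Suc n" for i j
    using that B symB by (metis carrier_matD index_transpose_mat(1))
  have A': "A' \<in> carrier_mat n n" "transpose_mat A' = A'"
    by (auto simp: A'_def symB')
  obtain V D where V: "V \<in> carrier_mat n n" and D: "D \<in> carrier_mat n n"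
    and VV: "transpose_mat V * V = 1\<^sub>m n" and diag: "diagonal_mat D"
    and A'V: "A' = V * D * transpose_mat V"
    using Suc.IH[OF A'] by blast
  define E where "E = mat 1 1 (\<lambda>_. e)"
  have E: "E \<in> carrier_mat 1 1" by (simp add: E_def)
  \<comment> \<open>The diagonalisation of the smaller block, padded with the eigenvalue
    \<open>e\<close> that was split off.\<close>
  define V1 where "V1 = four_block_mat (1\<^sub>m 1) (0\<^sub>m 1 n) (0\<^sub>m n 1) V"
  define D1 where "D1 = four_block_mat E (0\<^sub>m 1 n) (0\<^sub>m n 1) D"
  have V1: "V1 \<in> carrier_mat (Suc n) (Suc n)" and D1: "D1 \<in> carrier_mat (Suc n) (Suc n)"
    using V D E by (auto simp: V1_def D1_def)
  have V1T: "transpose_mat V1 = four_block_mat (1\<^sub>m 1) (0\<^sub>m 1 n) (0\<^sub>m n 1) (transpose_mat V)"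
    unfolding V1_def by (subst transpose_four_block_mat) (use V in auto)
  have VT: "transpose_mat V \<in> carrier_mat n n" using V by simp
  have one: "four_block_mat (1\<^sub>m 1) (0\<^sub>m 1 n) (0\<^sub>m n 1) (1\<^sub>m n) = (1\<^sub>m (Suc n) :: real mat)"
    by (rule eq_matI) auto
  have "transpose_mat V1 * V1 = four_block_mat (1\<^sub>m 1) (0\<^sub>m 1 n) (0\<^sub>m n 1) (transpose_mat V * V)"
    unfolding V1T unfolding V1_def
    by (subst mult_four_block_mat) (use V VT in auto)
  then have V1V1: "transpose_mat V1 * V1 = 1\<^sub>m (Suc n)" by (simp add: VV one)
  have VD: "V1 * D1 = four_block_mat E (0\<^sub>m 1 n) (0\<^sub>m n 1) (V * D)"
    unfolding V1_def D1_def by (subst mult_four_block_mat) (use V D E in auto)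
  have VDV: "V1 * D1 * transpose_mat V1 = four_block_mat E (0\<^sub>m 1 n) (0\<^sub>m n 1) A'"
    unfolding VD V1T A'V by (subst mult_four_block_mat) (use V D E VT in auto)
  have BB: "B = V1 * D1 * transpose_mat V1"
    unfolding VDV
  proof (rule eq_matI)
    fix i j
    assume "i < dim_row (four_block_mat E (0\<^sub>m 1 n) (0\<^sub>m n 1) A')"
      "j < dim_col (four_block_mat E (0\<^sub>m 1 n) (0\<^sub>m n 1) A')"
    then have ij: "i < Suc n" "j < Suc n" using E A' by auto
    show "B $$ (i,j) = four_block_mat E (0\<^sub>m 1 n) (0\<^sub>m n 1) A' $$ (i,j)"
      using ij E A' col0[OF ij(1)] col0[OF ij(2)] symB'[OF ij]
      by (cases i; cases j) (auto simp: E_def A'_def)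
  qed (use B E A' in auto)
  define U where "U = W * V1"
  have U: "U \<in> carrier_mat (Suc n) (Suc n)" using W V1 by (simp add: U_def)
  have UT: "transpose_mat U = transpose_mat V1 * transpose_mat W"
    unfolding U_def by (rule transpose_mult[OF W V1])
  have V1T': "transpose_mat V1 \<in> carrier_mat (Suc n) (Suc n)" using V1 by simp
  have "transpose_mat U * U = transpose_mat V1 * (transpose_mat W * W) * V1"
    unfolding UT unfolding U_def using W WT V1 V1T' by (simp add: assoc mult del: assoc_mult_mat)
  then have UU: "transpose_mat U * U = 1\<^sub>m (Suc n)" using V1T' V1V1 by (simp add: WW)
  have "A = U * D1 * transpose_mat U"
    unfolding UT unfolding U_def AB BB using W WT V1 V1T' D1
    by (simp add: assoc mult del: assoc_mult_mat)
  moreover have "diagonal_mat D1"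
    using diag D E by (auto simp: diagonal_mat_def D1_def less_Suc_eq_0_disj) metis
  ultimately show ?case using U D1 UU by blast
qed

text \<open>Turns matrix identities into finite sums over an orthonormal eigenbasis: column
  \<open>j\<close> of \<open>u\<close> is a unit eigenvector for \<open>e j\<close>. The square of
  \<open>A\<close> is recorded because the later arguments evaluate only quadratic polynomials at
  \<open>A\<close>.\<close>

lemma symmetric_mat_spectral:
  fixes A :: "real mat"
  assumes A: "A \<in> carrier_mat n n" and sym: "transpose_mat A = A"
  obtains u :: "nat \<Rightarrow> nat \<Rightarrow> real" and e :: "nat \<Rightarrow> real"
  where "\<And>j k. j < n \<Longrightarrow> k < n \<Longrightarrow> (\<Sum>a<n. u a j * u a k) = (if j = k then 1 else 0)"
    and "\<And>a b. a < n \<Longrightarrow> b < n \<Longrightarrow> (\<Sum>j<n. u a j * u b j) = (if a = b then 1 else 0)"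
    and "\<And>a b. a < n \<Longrightarrow> b < n \<Longrightarrow> A $$ (a,b) = (\<Sum>j<n. e j * u a j * u b j)"
    and "\<And>a b. a < n \<Longrightarrow> b < n \<Longrightarrow> (A * A) $$ (a,b) = (\<Sum>j<n. (e j)\<^sup>2 * u a j * u b j)"
    and "char_poly A = (\<Prod>a\<leftarrow>map e [0..<n]. [:- a, 1:])"
proof -
  obtain U D where U: "U \<in> carrier_mat n n" and D: "D \<in> carrier_mat n n"
    and UU: "transpose_mat U * U = 1\<^sub>m n"
    and diag: "diagonal_mat D" and AUD: "A = U * D * transpose_mat U"
    using symmetric_mat_orthogonally_diagonalizable[OF A sym] by blast
  have UT: "transpose_mat U \<in> carrier_mat n n" using U by simp
  have UU': "U * transpose_mat U = 1\<^sub>m n"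
    by (rule mat_mult_left_right_inverse[OF UT U UU])
  let ?u = "\<lambda>a j. U $$ (a,j)"
  define e where "e j = D $$ (j,j)" for j
  have D_index: "D $$ (j,k) = (if j = k then e j else 0)" if "j < n" "k < n" for j k
    using that D diag by (auto simp: diagonal_mat_def e_def)
  have DD_index: "(D * D) $$ (j,k) = (if j = k then (e j)\<^sup>2 else 0)" if "j < n" "k < n" for j k
  proof -
    have "(D * D) $$ (j,k) = (\<Sum>l<n. D $$ (j,l) * D $$ (l,k))"
      using that D by (simp add: scalar_prod_def atLeast0LessThan)
    also have "\<dots> = (\<Sum>l<n. if j = l then D $$ (j,l) * D $$ (l,k) else 0)"
      using that by (intro sum.cong) (auto simp: D_index)
    finally show ?thesis using that by (simp add: D_index power2_eq_square)
  qed
  \<comment> \<open>Stated for any diagonal \<open>F\<close>, to serve both \<open>D\<close> and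
    \<open>D * D\<close>.\<close>
  have conj_index: "(U * F * transpose_mat U) $$ (a,b) = (\<Sum>j<n. f j * ?u a j * ?u b j)"
    if F: "F \<in> carrier_mat n n" and Ff: "\<And>j k. j < n \<Longrightarrow> k < n \<Longrightarrow> F $$ (j,k) = (if j = k then f j else 0)"
      and ab: "a < n" "b < n" for F f a b
  proof -
    have UF: "(U * F) $$ (a,k) = ?u a k * f k" if "k < n" for k
    proof -
      have "(U * F) $$ (a,k) = (\<Sum>j<n. ?u a j * F $$ (j,k))"
        using that ab U F by (simp add: scalar_prod_def atLeast0LessThan)
      also have "\<dots> = (\<Sum>j<n. if j = k then ?u a j * f k else 0)"
        using that by (intro sum.cong) (auto simp: Ff)
      finally show ?thesis using that by simp
    qed
    have "(X * transpose_mat U) $$ (a,b) = (\<Sum>k<n. X $$ (a,k) * ?u b k)"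
      if "X \<in> carrier_mat n n" for X
      using ab U that by (simp add: scalar_prod_def atLeast0LessThan)
    from this[OF mult_carrier_mat[OF U F]]
    have "(U * F * transpose_mat U) $$ (a,b) = (\<Sum>k<n. (U * F) $$ (a,k) * ?u b k)" .
    also have "\<dots> = (\<Sum>k<n. f k * ?u a k * ?u b k)"
      by (intro sum.cong refl) (simp only: UF lessThan_iff mult_ac)
    finally show ?thesis .
  qed
  show ?thesis
  proof (rule that[of ?u e])
    fix j k assume jk: "j < n" "k < n"
    have "(transpose_mat U * U) $$ (j,k) = (\<Sum>a<n. ?u a j * ?u a k)"
      using jk U by (simp add: scalar_prod_def atLeast0LessThan)
    then show "(\<Sum>a<n. ?u a j * ?u a k) = (if j = k then 1 else 0)" using jk by (simp add: UU)
  next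
    fix a b assume ab: "a < n" "b < n"
    have "(U * transpose_mat U) $$ (a,b) = (\<Sum>j<n. ?u a j * ?u b j)"
      using ab U by (simp add: scalar_prod_def atLeast0LessThan)
    then show "(\<Sum>j<n. ?u a j * ?u b j) = (if a = b then 1 else 0)" using ab by (simp add: UU')
    show "A $$ (a,b) = (\<Sum>j<n. e j * ?u a j * ?u b j)"
      unfolding AUD by (rule conj_index[OF D D_index ab])
    let ?C = "carrier_mat n n :: real mat set"
    have mult: "X * Y \<in> ?C" if "X \<in> ?C" "Y \<in> ?C" for X Y using that by simp
    have assoc: "X * Y * Z = X * (Y * Z)" if "X \<in> ?C" "Y \<in> ?C" "Z \<in> ?C" for X Y Z
      using that by simp
    have "A * A = U * D * (transpose_mat U * U) * D * transpose_mat U"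
      unfolding AUD using U D UT by (simp add: assoc mult del: assoc_mult_mat)
    then have "A * A = U * (D * D) * transpose_mat U"
      unfolding UU using U D UT by (simp add: assoc mult del: assoc_mult_mat)
    then show "(A * A) $$ (a,b) = (\<Sum>j<n. (e j)\<^sup>2 * ?u a j * ?u b j)"
      using conj_index[OF mult[OF D D] DD_index ab] by simp
  next
    have "similar_mat A D"
      unfolding similar_mat_def
      using similar_mat_witI[OF UU' UU AUD A D U UT] by blast
    then have "char_poly A = char_poly D" by (rule char_poly_similar)
    also have "\<dots> = (\<Prod>a\<leftarrow>diag_mat D. [:- a, 1:])"
      using D diag by (intro char_poly_upper_triangular[OF D]) (auto simp: diagonal_mat_def)
    finally show "char_poly A = (\<Prod>a\<leftarrow>map e [0..<n]. [:- a, 1:])"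
      using D by (simp add: diag_mat_def e_def[abs_def])
  qed
qed

section \<open>Eigenvalues with multiplicity, in decreasing order\<close>

lemma proots_prod_list_linear:
  "proots (\<Prod>a\<leftarrow>xs. [:- a, 1:]) = mset (xs :: 'a :: idom list)"
proof (induction xs)
  case (Cons x xs)
  have "(\<Prod>a\<leftarrow>xs. [:- a, 1:]) \<noteq> (0 :: 'a poly)" by (auto simp: prod_list_zero_iff)
  then show ?case using Cons
    by (simp only: list.map prod_list.Cons, subst proots_mult) auto
qed auto

lemma eigval_desc_1:
  assumes "proots (char_poly A) \<noteq> {#}"
  shows "eigval_desc A 1 = Max (set_mset (proots (char_poly A)))"
proof -
  let ?xs = "sorted_list_of_multiset (proots (char_poly A))"
  have ne: "?xs \<noteq> []" using assms by (metis mset.simps(1) mset_sorted_list_of_multiset)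
  then have "eigval_desc A 1 = last ?xs"
    by (simp add: eigval_desc_def rev_nth last_conv_nth)
  also have "\<dots> = Max (set ?xs)"
  proof (rule Max_eqI[symmetric])
    fix y assume "y \<in> set ?xs"
    then obtain k where "k < length ?xs" "y = ?xs ! k" by (metis in_set_conv_nth)
    with ne show "y \<le> last ?xs"
      unfolding last_conv_nth[OF ne]
      by (metis One_nat_def Suc_pred diff_less less_Suc_eq_le less_nat_zero_code less_one
          linorder_neqE_nat sorted_nth_mono sorted_sorted_list_of_multiset)
  next
    show "last ?xs \<in> set ?xs" using ne by (rule last_in_set)
  qed simp
  finally show ?thesis by simp
qed

text \<open>Serves to bound \<open>ratio_lambda\<close>, whose minimum runs over the indices from 2
  on: index 1 holds the largest eigenvalue, so any other one sits later in the list.\<close>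

lemma eigval_desc_surj:
  assumes x: "x \<in># proots (char_poly A)" and ne: "x \<noteq> eigval_desc A 1"
  shows "\<exists>j\<in>{2..size (proots (char_poly A))}. eigval_desc A j = x"
proof -
  let ?xs = "rev (sorted_list_of_multiset (proots (char_poly A)))"
  have len: "length ?xs = size (proots (char_poly A))"
    by (simp flip: size_mset)
  have "x \<in> set ?xs" using x by simp
  then obtain k where k: "k < length ?xs" "?xs ! k = x" by (metis in_set_conv_nth)
  \<comment> \<open>\<open>eigval_desc\<close> counts from 1, list positions count from 0.\<close>
  then have "eigval_desc A (Suc k) = x" by (simp add: eigval_desc_def)
  moreover from this ne have "k \<noteq> 0" by (cases k) auto
  ultimately show ?thesis using k len by (intro bexI[of _ "Suc k"]) auto
qed

section \<open>Entries of the adjacency matrix and of its square\<close>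

lemma adjacency_matrix_carrier: "adjacency_matrix n v G \<in> carrier_mat n n"
  by (simp add: adjacency_matrix_def)

lemma adjacency_matrix_index:
  "a < n \<Longrightarrow> b < n \<Longrightarrow> adjacency_matrix n v G $$ (a,b) = (if (v a, v b) \<in> parcs G then 1 else 0)"
  by (simp add: adjacency_matrix_def)

lemma adjacency_matrix_square_index:
  assumes "a < n" "b < n"
  shows "(adjacency_matrix n v G * adjacency_matrix n v G) $$ (a,b) =
    real (card {c. c < n \<and> (v a, v c) \<in> parcs G \<and> (v c, v b) \<in> parcs G})"
proof -
  let ?A = "adjacency_matrix n v G"
  have "(?A * ?A) $$ (a,b) = (\<Sum>c<n. ?A $$ (a,c) * ?A $$ (c,b))"
    using assms by (simp add: adjacency_matrix_def scalar_prod_def atLeast0LessThan)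
  also have "\<dots> = (\<Sum>c<n. if (v a, v c) \<in> parcs G \<and> (v c, v b) \<in> parcs G then 1 else 0)"
    using assms by (intro sum.cong) (auto simp: adjacency_matrix_index)
  also have "\<dots> = real (card {c. c < n \<and> (v a, v c) \<in> parcs G \<and> (v c, v b) \<in> parcs G})"
    by (subst sum.inter_filter[symmetric]) (auto simp: lessThan_def intro!: arg_cong[where f = card])
  finally show ?thesis .
qed

lemma pair_graph_sym: "pair_graph G \<Longrightarrow> (x, y) \<in> parcs G \<Longrightarrow> (y, x) \<in> parcs G"
proof -
  assume "pair_graph G" and xy: "(x, y) \<in> parcs G"
  then interpret pair_graph G by simp
  show ?thesis using xy pair_sym_arcs by (auto simp: symmetric_def sym_def)
qed

lemma adjacency_matrix_sym:
  assumes "pair_graph G"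
  shows "transpose_mat (adjacency_matrix n v G) = adjacency_matrix n v G"
  by (rule eq_matI) (auto simp: adjacency_matrix_def dest: pair_graph_sym[OF assms])

lemma adjacency_matrix_diag:
  assumes "pair_graph G" "a < n"
  shows "adjacency_matrix n v G $$ (a,a) = 0"
proof -
  interpret pair_graph G by fact
  show ?thesis using assms pair_no_loops[of "(v a, v a)"] by (auto simp: adjacency_matrix_index)
qed

text \<open>The diagonal entry counts closed walks of length two. Arcs come in opposite pairs, so
  each out-arc of a vertex extends to exactly one such walk.\<close>

lemma adjacency_matrix_square_diag:
  assumes "pair_graph G" and v: "bij_betw v {..<n} (pverts G)" and a: "a < n"
  shows "(adjacency_matrix n v G * adjacency_matrix n v G) $$ (a,a) = real (out_degree (with_proj G) (v a))"
proof -
  interpret pair_graph G by fact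
  have "bij_betw (\<lambda>c. (v a, v c)) {c. c < n \<and> (v a, v c) \<in> parcs G} {f \<in> parcs G. fst f = v a}"
    unfolding bij_betw_def
  proof
    show "inj_on (\<lambda>c. (v a, v c)) {c. c < n \<and> (v a, v c) \<in> parcs G}"
      using v by (auto simp: inj_on_def bij_betw_def)
    show "(\<lambda>c. (v a, v c)) ` {c. c < n \<and> (v a, v c) \<in> parcs G} = {f \<in> parcs G. fst f = v a}"
    proof (intro equalityI subsetI)
      fix f assume f: "f \<in> {f \<in> parcs G. fst f = v a}"
      then have "snd f \<in> v ` {..<n}" using arc_snd_in_verts v by (auto simp: bij_betw_def)
      then obtain c where "c < n" "snd f = v c" by auto
      moreover from this f have "f = (v a, v c)" by (simp add: prod_eq_iff)
      ultimately show "f \<in> (\<lambda>c. (v a, v c)) ` {c. c < n \<and> (v a, v c) \<in> parcs G}"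
        using f by blast
    qed auto
  qed
  then have "card {c. c < n \<and> (v a, v c) \<in> parcs G} = card {f \<in> parcs G. fst f = v a}"
    by (rule bij_betw_same_card)
  moreover have "{c. c < n \<and> (v a, v c) \<in> parcs G \<and> (v c, v a) \<in> parcs G}
      = {c. c < n \<and> (v a, v c) \<in> parcs G}"
    using pair_graph_sym[OF assms(1)] by auto
  ultimately show ?thesis
    by (simp add: adjacency_matrix_square_index[OF a a] out_degree_def out_arcs_def with_proj_def)
qed

lemma out_degree_le_max_degree:
  "finite (pverts G) \<Longrightarrow> x \<in> pverts G \<Longrightarrow> out_degree (with_proj G) x \<le> max_degree G"
  by (simp add: max_degree_def)

lemma max_degree_attained:
  assumes "finite (pverts G)" "pverts G \<noteq> {}"
  obtains x where "x \<in> pverts G" "out_degree (with_proj G) x = max_degree G"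
proof -
  have "max_degree G \<in> out_degree (with_proj G) ` pverts G"
    unfolding max_degree_def using assms by (intro Max_in) auto
  then show ?thesis using that by force
qed

section \<open>Distances and distance colourings\<close>

lemma graph_dist_adjacent:
  assumes "pair_graph G" and "(x, y) \<in> parcs G"
  shows "graph_dist G x y \<le> 1"
proof -
  interpret pair_graph G by fact
  have "x \<in> pverts G" "y \<in> pverts G"
    using arc_fst_in_verts[OF assms(2)] arc_snd_in_verts[OF assms(2)] by auto
  then have "awalk x [(x, y)] y"
    using assms(2) by (auto simp: awalk_def)
  from min_cost_le_walk_cost[OF this, of "\<lambda>_. 1"] show ?thesis
    by (simp add: graph_dist_def awalk_cost_def one_ereal_def)
qed

lemma graph_dist_common_neighbour:
  assumes "pair_graph G" and "(x, z) \<in> parcs G" "(z, y) \<in> parcs G"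
  shows "graph_dist G x y \<le> 2"
proof -
  interpret pair_graph G by fact
  have "x \<in> pverts G" "z \<in> pverts G" "y \<in> pverts G"
    using arc_fst_in_verts[OF assms(2)] arc_snd_in_verts[OF assms(2)] arc_snd_in_verts[OF assms(3)] by auto
  then have "awalk x [(x, z), (z, y)] y"
    using assms by (auto simp: awalk_def)
  from min_cost_le_walk_cost[OF this, of "\<lambda>_. 1"] show ?thesis
    by (simp add: graph_dist_def awalk_cost_def)
qed

text \<open>An arc or a common neighbour would give a walk of length at most 2, whereas distinct
  vertices of equal colour are farther apart.\<close>

lemma distance_coloring_2_no_walk:
  assumes G: "pair_graph G" and c: "distance_coloring 2 G c"
    and v: "bij_betw v {..<n} (pverts G)"
    and ab: "a < n" "b < n" "a \<noteq> b" and eq: "c (v a) = c (v b)"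
  shows "adjacency_matrix n v G $$ (a,b) = 0"
    and "(adjacency_matrix n v G * adjacency_matrix n v G) $$ (a,b) = 0"
proof -
  have verts: "v a \<in> pverts G" "v b \<in> pverts G" using v ab by (auto simp: bij_betw_def)
  have "v a \<noteq> v b" using v ab by (auto simp: bij_betw_def inj_on_def)
  with c eq verts have far: "\<not> graph_dist G (v a) (v b) \<le> 2"
    unfolding distance_coloring_def by (metis numeral_eq_ereal of_nat_numeral)
  have "(v a, v b) \<notin> parcs G"
  proof
    assume "(v a, v b) \<in> parcs G"
    then have "graph_dist G (v a) (v b) \<le> 1" by (rule graph_dist_adjacent[OF G])
    also have "(1 :: ereal) \<le> 2" by simp
    finally show False using far by simp
  qed
  then show "adjacency_matrix n v G $$ (a,b) = 0" using ab by (simp add: adjacency_matrix_index)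
  have "{d. d < n \<and> (v a, v d) \<in> parcs G \<and> (v d, v b) \<in> parcs G} = {}"
    using far graph_dist_common_neighbour[OF G] by blast
  then show "(adjacency_matrix n v G * adjacency_matrix n v G) $$ (a,b) = 0"
    by (simp only: adjacency_matrix_square_index[OF ab(1,2)]) simp
qed

text \<open>An injective colouring is a distance colouring for every \<open>t\<close>, so the
  \<open>LEAST\<close> is taken over a nonempty set.\<close>

lemma distance_chromatic_number_attained:
  assumes "finite (pverts G)"
  obtains c where "distance_coloring t G c" "card (c ` pverts G) = distance_chromatic_number t G"
proof -
  obtain c :: "'a \<Rightarrow> nat" where "inj_on c (pverts G)"
    using assms finite_imp_inj_to_nat_seg by blast
  then have "distance_coloring t G c"
    by (auto simp: distance_coloring_def inj_on_def)
  then have "\<exists>k. \<exists>c. distance_coloring t G c \<and> card (c ` pverts G) = k" by blast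
  from LeastI_ex[OF this] show ?thesis
    using that unfolding distance_chromatic_number_def by blast
qed

section \<open>Cauchy-Schwarz over the colour classes\<close>

text \<open>
  The rows of \<open>u\<close> are split by colour; Cauchy--Schwarz over the colours, applied to the eigenvector
  with index \<open>j0\<close>, loses a factor of at most the number of colours.
\<close>

lemma ratio_colouring_bound:
  fixes u :: "nat \<Rightarrow> nat \<Rightarrow> real" and q :: "nat \<Rightarrow> real" and c :: "nat \<Rightarrow> 'c"
  assumes orth: "\<And>j k. j < n \<Longrightarrow> k < n \<Longrightarrow> (\<Sum>a<n. u a j * u a k) = (if j = k then 1 else 0)"
    and q: "\<And>j. j < n \<Longrightarrow> q j \<ge> 0" and j0: "j0 < n"
    and off: "\<And>a b. a < n \<Longrightarrow> b < n \<Longrightarrow> a \<noteq> b \<Longrightarrow> c a = c b \<Longrightarrow> (\<Sum>j<n. q j * u a j * u b j) = 0"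
    and diag: "\<And>a. a < n \<Longrightarrow> (\<Sum>j<n. q j * u a j * u a j) \<le> W"
  shows "q j0 \<le> real (card (c ` {..<n})) * W"
proof -
  let ?S = "c ` {..<n}" and ?x = "\<lambda>a. u a j0"
  define K where "K s = {a. a < n \<and> c a = s}" for s
  have K: "finite (K s)" for s by (simp add: K_def)
  have group: "(\<Sum>s\<in>?S. sum g (K s)) = sum g {..<n}" for g :: "nat \<Rightarrow> real"
    using sum.group[of "{..<n}" ?S c g] by (simp add: K_def)
  \<comment> \<open>\<open>y s j\<close> is the \<open>j\<close>-th coordinate, in the eigenbasis,
    of the eigenvector \<open>?x\<close> restricted to the colour class \<open>s\<close>. The
    restrictions add up to \<open>?x\<close>.\<close>
  define y where "y s j = (\<Sum>a\<in>K s. u a j * ?x a)" for s j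
  have y_sum: "(\<Sum>s\<in>?S. y s j0) = 1"
    using group[of "\<lambda>a. u a j0 * ?x a"] orth[OF j0 j0] by (simp add: y_def)
  have class_bound: "q j0 * (y s j0)\<^sup>2 \<le> W * (\<Sum>a\<in>K s. (?x a)\<^sup>2)" for s
  proof -
    \<comment> \<open>The right side is the quadratic form with eigenvalues \<open>q j\<close> at
      the restricted vector; all its terms are nonnegative, so it dominates the one for
      \<open>j0\<close>.\<close>
    have "q j0 * (y s j0)\<^sup>2 \<le> (\<Sum>j<n. q j * (y s j)\<^sup>2)"
      using j0 q by (intro member_le_sum) auto
    also have "\<dots> = (\<Sum>j<n. \<Sum>a\<in>K s. \<Sum>b\<in>K s. ?x a * ?x b * (q j * u a j * u b j))"
      by (intro sum.cong refl)
        (simp add: y_def power2_eq_square sum_product sum_distrib_left mult_ac)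
    also have "\<dots> = (\<Sum>a\<in>K s. \<Sum>j<n. \<Sum>b\<in>K s. ?x a * ?x b * (q j * u a j * u b j))"
      by (rule sum.swap)
    also have "\<dots> = (\<Sum>a\<in>K s. \<Sum>b\<in>K s. ?x a * ?x b * (\<Sum>j<n. q j * u a j * u b j))"
      unfolding sum_distrib_left by (rule sum.cong[OF refl], rule sum.swap)
    \<comment> \<open>Within one colour class \<open>off\<close> leaves only the diagonal
      entries.\<close>
    also have "\<dots> = (\<Sum>a\<in>K s. \<Sum>b\<in>K s. if a = b then (?x a)\<^sup>2 * (\<Sum>j<n. q j * u a j * u a j) else 0)"
      by (intro sum.cong refl) (auto simp: K_def off power2_eq_square)
    also have "\<dots> = (\<Sum>a\<in>K s. (?x a)\<^sup>2 * (\<Sum>j<n. q j * u a j * u a j))"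
      by (intro sum.cong refl) (simp add: K)
    also have "\<dots> \<le> (\<Sum>a\<in>K s. (?x a)\<^sup>2 * W)"
      by (intro sum_mono mult_left_mono) (auto simp: K_def diag)
    finally show ?thesis by (simp add: sum_distrib_left mult.commute)
  qed
  have "1 = (\<Sum>s\<in>?S. y s j0)\<^sup>2" by (simp add: y_sum)
  also have "\<dots> \<le> real (card ?S) * (\<Sum>s\<in>?S. (y s j0)\<^sup>2)"
  proof -
    \<comment> \<open>Cauchy-Schwarz in the form of Lagrange's identity: the squared pairwise
      differences add up to twice the defect of the inequality.\<close>
    have "0 \<le> (\<Sum>s\<in>?S. \<Sum>t\<in>?S. (y s j0 - y t j0)\<^sup>2)" by (intro sum_nonneg) auto
    also have "\<dots> = 2 * (real (card ?S) * (\<Sum>s\<in>?S. (y s j0)\<^sup>2) - (\<Sum>s\<in>?S. y s j0)\<^sup>2)"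
      by (simp add: power2_diff sum.distrib sum_subtractf algebra_simps
          flip: sum_distrib_left sum_distrib_right)
        (simp add: power2_eq_square)
    finally show ?thesis by simp
  qed
  finally have "q j0 \<le> q j0 * (real (card ?S) * (\<Sum>s\<in>?S. (y s j0)\<^sup>2))"
    using q[OF j0] mult_left_mono by fastforce
  also have "\<dots> = real (card ?S) * (\<Sum>s\<in>?S. q j0 * (y s j0)\<^sup>2)"
    by (simp add: sum_distrib_left mult_ac)
  also have "\<dots> \<le> real (card ?S) * (\<Sum>s\<in>?S. W * (\<Sum>a\<in>K s. (?x a)\<^sup>2))"
    by (intro mult_left_mono sum_mono class_bound) simp
  also have "(\<Sum>s\<in>?S. W * (\<Sum>a\<in>K s. (?x a)\<^sup>2)) = W"
    using group[of "\<lambda>a. (?x a)\<^sup>2"] orth[OF j0 j0]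
    by (simp add: power2_eq_square flip: sum_distrib_left)
  finally show ?thesis .
qed

section \<open>A three-point quadrature\<close>

text \<open>
  The functional sending $x^2, x, 1$ to $D, 0, 1$ is a nonnegative combination of the evaluations at
  \<open>t\<close>, \<open>r\<close>, \<open>s\<close>; the conclusion keeps only the evaluation at \<open>t\<close>.
\<close>

lemma three_point_quadrature:
  fixes t r s D c0 c1 c2 :: real
  assumes "s < r" "r < t" "D + t * r \<ge> 0" "D + t * s \<le> 0"
    and "c2 * r\<^sup>2 + c1 * r + c0 \<ge> 0" "c2 * s\<^sup>2 + c1 * s + c0 \<ge> 0"
  shows "(D + s * r) * (c2 * t\<^sup>2 + c1 * t + c0) \<le> (t - s) * (t - r) * (c2 * D + c0)"
proof -
  \<comment> \<open>The Lagrange interpolation identity at \<open>t\<close>, \<open>r\<close>,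
    \<open>s\<close> with denominators cleared. The sign assumptions on \<open>D + t * r\<close> and
    \<open>D + t * s\<close> make the weights of \<open>s\<close> and \<open>r\<close>,
    respectively, nonnegative.\<close>
  have "(r - s) * ((t - s) * (t - r) * (c2 * D + c0) - (D + s * r) * (c2 * t\<^sup>2 + c1 * t + c0))
    = (t - s) * - (D + t * s) * (c2 * r\<^sup>2 + c1 * r + c0)
      + (t - r) * (D + t * r) * (c2 * s\<^sup>2 + c1 * s + c0)"
    by (simp add: algebra_simps power2_eq_square)
  also have "\<dots> \<ge> 0"
    by (rule add_nonneg_nonneg; rule mult_nonneg_nonneg; (rule mult_nonneg_nonneg)?)
      (use assms in auto)
  finally show ?thesis using assms(1) by (simp add: zero_le_mult_iff)
qed

section \<open>Quadratic polynomials of numbers and of matrices\<close>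

lemma poly_degree_le_2:
  fixes p :: "real poly"
  assumes "degree p \<le> 2"
  shows "poly p x = coeff p 2 * x\<^sup>2 + coeff p 1 * x + coeff p 0"
proof -
  have "poly p x = (\<Sum>k\<le>2. coeff p k * x ^ k)"
    unfolding poly_altdef using assms
    by (intro sum.mono_neutral_left) (auto simp: coeff_eq_0)
  then show ?thesis by (simp add: numeral_2_eq_2)
qed

lemma poly_mat_diag_degree_le_2:
  assumes A: "A \<in> carrier_mat n n" and a: "a < n" and "degree p \<le> 2"
  shows "poly_mat p A $$ (a,a) =
    coeff p 2 * (A * A) $$ (a,a) + coeff p 1 * A $$ (a,a) + coeff p 0"
proof -
  have "poly_mat p A $$ (a,a) = (\<Sum>k\<le>2. coeff p k * (A ^\<^sub>m k) $$ (a,a))"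
    unfolding poly_mat_def using assms
    by (simp, intro sum.mono_neutral_left) (auto simp: coeff_eq_0)
  moreover have "A ^\<^sub>m 2 = A * A" "A ^\<^sub>m 1 = A" "A ^\<^sub>m 0 = 1\<^sub>m n"
    using A by (auto simp: numeral_2_eq_2)
  moreover have "{..2::nat} = {0,1,2}" by auto
  ultimately show ?thesis using a by simp
qed

section \<open>The ratio bound for distance-2 colourings\<close>

theorem theorem2p3:
  fixes G :: "'a pair_pre_digraph"
    and v :: "nat \<Rightarrow> 'a"
    and A :: "real mat"
    and \<theta> :: "nat \<Rightarrow> real"
    and \<Delta> :: real
    and n d i :: nat
  assumes graph: "pair_graph G"
    and enum: "bij_betw v {..<n} (pverts G)"
    and A_def: "A = adjacency_matrix n v G"
    and eigvals: "{k. eigenvalue A k} = \<theta> ` {0..d}"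
    and decr: "strict_antimono_on {0..d} \<theta>"
    and d: "d \<ge> 2"
    and \<Delta>_def: "\<Delta> = real (max_degree G)"
    and i: "i \<le> d" "\<theta> i \<le> - \<Delta> / \<theta> 0"
    and i_largest: "\<And>j. j \<le> d \<Longrightarrow> \<theta> j \<le> - \<Delta> / \<theta> 0 \<Longrightarrow> \<theta> j \<le> \<theta> i"
  shows "real (distance_chromatic_number 2 G)
           \<ge> (\<theta> 0 - \<theta> i) * (\<theta> 0 - \<theta> (i - 1)) / (\<Delta> + \<theta> i * \<theta> (i - 1))
       \<and> (\<forall>p :: real poly. degree p \<le> 2 \<and> poly p (eigval_desc A 1) > ratio_lambda A p \<longrightarrow>
            (poly p (eigval_desc A 1) - ratio_lambda A p) / (ratio_W A p - ratio_lambda A p)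
              \<le> (\<theta> 0 - \<theta> i) * (\<theta> 0 - \<theta> (i - 1)) / (\<Delta> + \<theta> i * \<theta> (i - 1)))"
proof -
  have A: "A \<in> carrier_mat n n" by (simp add: A_def adjacency_matrix_carrier)
  have symA: "transpose_mat A = A" unfolding A_def by (rule adjacency_matrix_sym[OF graph])
  have verts: "v a \<in> pverts G" if "a < n" for a
    using enum that by (auto simp: bij_betw_def)
  have fin: "finite (pverts G)" using enum bij_betw_finite by blast
  obtain u e where
    col_orth: "\<And>j k. j < n \<Longrightarrow> k < n \<Longrightarrow> (\<Sum>a<n. u a j * u a k) = (if j = k then 1 else (0::real))"
    and row_orth: "\<And>a b. a < n \<Longrightarrow> b < n \<Longrightarrow> (\<Sum>j<n. u a j * u b j) = (if a = b then 1 else 0)"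
    and A1: "\<And>a b. a < n \<Longrightarrow> b < n \<Longrightarrow> A $$ (a,b) = (\<Sum>j<n. e j * u a j * u b j)"
    and A2: "\<And>a b. a < n \<Longrightarrow> b < n \<Longrightarrow> (A * A) $$ (a,b) = (\<Sum>j<n. (e j)\<^sup>2 * u a j * u b j)"
    and cp: "char_poly A = (\<Prod>a\<leftarrow>map e [0..<n]. [:- a, 1:])"
    using symmetric_mat_spectral[OF A symA] by blast
  have roots: "proots (char_poly A) = mset (map e [0..<n])"
    unfolding cp by (rule proots_prod_list_linear)
  have "char_poly A \<noteq> 0" using degree_monic_char_poly[OF A] by auto
  then have "set_mset (proots (char_poly A)) = {k. eigenvalue A k}"
    by (simp add: eigenvalue_root_char_poly[OF A])
  then have spec: "set_mset (proots (char_poly A)) = \<theta> ` {0..d}" by (simp add: eigvals)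
  then have e_image: "e ` {..<n} = \<theta> ` {0..d}" by (simp add: roots atLeast0LessThan)

  have less: "\<theta> k < \<theta> j" if "j < k" "k \<le> d" for j k
    using decr that by (auto simp: monotone_on_def)
  have le: "\<theta> k \<le> \<theta> j" if "j \<le> k" "k \<le> d" for j k
    using less[of j k] that by (cases "j = k") auto
  \<comment> \<open>The trace of a function of \<open>A\<close> is the sum of its values at the
    eigenvalues, because the columns of \<open>u\<close> are unit vectors.\<close>
  have trace: "(\<Sum>a<n. \<Sum>j<n. g j * u a j * u a j) = (\<Sum>j<n. g j)" for g
  proof -
    have "(\<Sum>a<n. \<Sum>j<n. g j * u a j * u a j) = (\<Sum>j<n. \<Sum>a<n. g j * (u a j * u a j))"
      by (subst sum.swap) (simp add: mult.assoc)
    also have "\<dots> = (\<Sum>j<n. g j * 1)"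
      by (intro sum.cong) (simp_all add: col_orth flip: sum_distrib_left)
    finally show ?thesis by simp
  qed
  have diag_A: "A $$ (a,a) = 0" if "a < n" for a
    unfolding A_def by (rule adjacency_matrix_diag[OF graph that])
  have diag_AA: "(A * A) $$ (a,a) = real (out_degree (with_proj G) (v a))" if "a < n" for a
    unfolding A_def by (rule adjacency_matrix_square_diag[OF graph enum that])

  \<comment> \<open>\<open>A\<close> has trace zero, so without a positive eigenvalue all
    eigenvalues would be zero, contradicting that \<open>\<theta> 0\<close> and
    \<open>\<theta> 1\<close> differ.\<close>
  have pos: "\<theta> 0 > 0"
  proof (rule ccontr)
    assume "\<not> \<theta> 0 > 0"
    then have np: "e j \<le> 0" if "j < n" for j
    proof -
      have "e j \<in> \<theta> ` {0..d}" using that e_image by blast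
      then show ?thesis using le[of 0] \<open>\<not> \<theta> 0 > 0\<close> by force
    qed
    have "(\<Sum>j<n. e j) = (\<Sum>a<n. A $$ (a,a))"
      unfolding trace[of e, symmetric] by (simp add: A1)
    then have "(\<Sum>j<n. e j) = 0" by (simp add: diag_A)
    then have "(\<Sum>j<n. - e j) = 0" by (simp add: sum_negf)
    then have "\<forall>j\<in>{..<n}. e j = 0"
      using np by (subst (asm) sum_nonneg_eq_0_iff) auto
    then have "\<theta> ` {0..d} \<subseteq> {0}" unfolding e_image[symmetric] by auto
    then have "\<theta> 0 = 0" "\<theta> 1 = 0" using d by (simp_all add: image_subset_iff)
    then show False using less[of 0 1] d by simp
  qed
  have \<Delta>0: "\<Delta> \<ge> 0" by (simp add: \<Delta>_def)
  define s r where "s = \<theta> i" and "r = \<theta> (i - 1)"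
  \<comment> \<open>Natural subtraction truncates, so this is what makes
    \<open>\<theta> (i - 1)\<close> the eigenvalue just above \<open>\<theta> i\<close>. It holds
    since the threshold is nonpositive while \<open>\<theta> 0\<close> is positive.\<close>
  have i0: "i > 0"
  proof (rule ccontr)
    assume "\<not> i > 0"
    then have "\<theta> 0 \<le> - \<Delta> / \<theta> 0" using i by simp
    also have "\<dots> \<le> 0" using pos \<Delta>0 by (simp add: divide_nonpos_pos)
    finally show False using pos by simp
  qed
  have sr: "s < r" unfolding s_def r_def using i0 i by (intro less) auto
  have ts: "\<Delta> + \<theta> 0 * s \<le> 0"
    using i(2) pos by (simp add: s_def pos_le_divide_eq pos_le_minus_divide_eq algebra_simps)
  \<comment> \<open>By the maximality of \<open>\<theta> i\<close>, the next larger eigenvalue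
    misses the threshold.\<close>
  have "\<not> r \<le> - \<Delta> / \<theta> 0"
    using i_largest[of "i - 1"] sr i unfolding s_def r_def by linarith
  then have tr: "\<Delta> + \<theta> 0 * r \<ge> 0"
    using pos by (simp add: field_simps)

  \<comment> \<open>The quadratic \<open>q\<close> on the spectrum and on the diagonal\<close>
  define q where "q x = (x - r) * (x - s)" for x
  have q_nonneg: "q (\<theta> j) \<ge> 0" if "j \<le> d" for j
  proof (cases "j < i")
    case True
    then have "\<theta> j \<ge> r" unfolding r_def using i by (intro le) auto
    then show ?thesis using sr by (simp add: q_def)
  next
    case False
    then have "\<theta> j \<le> s" unfolding s_def using that by (intro le) auto
    then show ?thesis using sr by (simp add: q_def mult_nonpos_nonpos)
  qed
  have q_e: "q (e j) \<ge> 0" if "j < n" for j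
  proof -
    have "e j \<in> \<theta> ` {0..d}" using that e_image by blast
    then show ?thesis using q_nonneg by auto
  qed
  \<comment> \<open>The entries of $q(A) = A^2 - (r + s) A + r s I$, with the left side in spectral
    form. On the diagonal this is the degree plus \<open>r * s\<close>.\<close>
  have qA: "(\<Sum>j<n. q (e j) * u a j * u b j)
      = (A * A) $$ (a,b) - (r + s) * A $$ (a,b) + r * s * (if a = b then 1 else 0)"
    if "a < n" "b < n" for a b
  proof -
    have "(\<Sum>j<n. q (e j) * u a j * u b j) = (\<Sum>j<n. (e j)\<^sup>2 * u a j * u b j
        - (r + s) * (e j * u a j * u b j) + r * s * (u a j * u b j))"
      by (intro sum.cong refl) (simp add: q_def algebra_simps power2_eq_square)
    then show ?thesis
      unfolding A1[OF that] A2[OF that] row_orth[OF that, symmetric] sum_distrib_left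
      by (simp only: sum.distrib sum_subtractf)
  qed
  have q_diag: "(\<Sum>j<n. q (e j) * u a j * u a j) \<le> \<Delta> + s * r" if "a < n" for a
    using out_degree_le_max_degree[OF fin verts[OF that]]
    by (simp add: qA that diag_A diag_AA \<Delta>_def)

  \<comment> \<open>As $d \ge 2$, some eigenvalue is a root of neither factor of \<open>q\<close>, so the trace of $q(A)$ is positive.\<close>
  have D: "\<Delta> + s * r > 0"
  proof -
    have "\<exists>k\<in>{0,1,2}. k \<noteq> i \<and> k \<noteq> i - 1" using i0 by auto
    then obtain k where "k \<in> {0,1,2}" "k \<noteq> i" "k \<noteq> i - 1" by blast
    then have k: "k \<le> d" "k \<noteq> i" "k \<noteq> i - 1" using d by auto
    have inj: "\<theta> j \<noteq> \<theta> l" if "j \<le> d" "l \<le> d" "j \<noteq> l" for j l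
      using less[of j l] less[of l j] that by (cases j l rule: linorder_cases) auto
    have "q (\<theta> k) \<noteq> 0"
      using inj[of k i] inj[of k "i - 1"] k i by (simp add: q_def s_def r_def)
    with q_nonneg[OF k(1)] have "q (\<theta> k) > 0" by simp
    moreover have "\<theta> k \<in> e ` {..<n}" unfolding e_image using k by simp
    ultimately obtain j where j: "j < n" "q (e j) > 0" by auto
    have "0 < (\<Sum>j<n. q (e j))"
      by (rule sum_pos2[of _ j]) (use j q_e in auto)
    also have "\<dots> = (\<Sum>a<n. \<Sum>j<n. q (e j) * u a j * u a j)"
      by (rule trace[symmetric])
    also have "\<dots> \<le> (\<Sum>a<n. \<Delta> + s * r)" by (intro sum_mono q_diag) auto
    finally show ?thesis by (simp add: zero_less_mult_iff)
  qed
  have rt: "r < \<theta> 0"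
  proof -
    \<comment> \<open>For \<open>i = 1\<close> one would have \<open>r = \<theta> 0\<close>, and
      then \<open>ts\<close> would contradict the positivity \<open>D\<close>.\<close>
    have "i \<noteq> 1" using D ts by (auto simp: s_def r_def mult.commute)
    then show ?thesis unfolding r_def using i0 i by (intro less) auto
  qed

  \<comment> \<open>The lower bound on the chromatic number\<close>
  have "real (distance_chromatic_number 2 G) * (\<Delta> + s * r) \<ge> q (\<theta> 0)"
  proof -
    obtain c where c: "distance_coloring 2 G c" "card (c ` pverts G) = distance_chromatic_number 2 G"
      by (rule distance_chromatic_number_attained[OF fin])
    have "\<theta> 0 \<in> e ` {..<n}" unfolding e_image by simp
    then obtain j0 where j0: "j0 < n" "e j0 = \<theta> 0" by auto
    have "q (e j0) \<le> real (card ((\<lambda>a. c (v a)) ` {..<n})) * (\<Delta> + s * r)"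
    proof (rule ratio_colouring_bound[where u = u])
      fix a b assume ab: "a < n" "b < n" "a \<noteq> b" "c (v a) = c (v b)"
      show "(\<Sum>j<n. q (e j) * u a j * u b j) = 0"
        using distance_coloring_2_no_walk[OF graph c(1) enum ab] ab by (simp add: qA A_def)
    qed (use col_orth q_e q_diag j0 in auto)
    moreover have "(\<lambda>a. c (v a)) ` {..<n} = c ` pverts G"
      using bij_betw_imp_surj_on[OF enum] by (metis image_image)
    ultimately show ?thesis by (simp add: j0 c(2))
  qed
  then have chi: "(\<theta> 0 - s) * (\<theta> 0 - r) / (\<Delta> + s * r) \<le> real (distance_chromatic_number 2 G)"
    using D by (simp add: divide_le_eq q_def mult.commute)

  \<comment> \<open>Optimality among polynomials of degree at most two\<close>
  have roots_ne: "proots (char_poly A) \<noteq> {#}"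
    using spec by (metis atLeastAtMost_iff empty_iff image_eqI le0 set_mset_empty)
  have top: "eigval_desc A 1 = \<theta> 0"
    unfolding eigval_desc_1[OF roots_ne] spec by (intro Max_eqI) (auto intro: le)
  have n_size: "size (proots (char_poly A)) = n" by (simp add: roots)
  have lambda_le: "ratio_lambda A p \<le> poly p (\<theta> j)" if j: "j \<le> d" "\<theta> j \<noteq> \<theta> 0" for p j
  proof -
    have "\<theta> j \<in># proots (char_poly A)" using j spec by auto
    then obtain k where k: "k \<in> {2..n}" "eigval_desc A k = \<theta> j"
      using eigval_desc_surj[of "\<theta> j" A] j(2) unfolding top n_size by blast
    have "ratio_lambda A p \<le> poly p (eigval_desc A k)"
      unfolding ratio_lambda_def using k(1) A by (intro Min_le imageI) auto
    then show ?thesis by (simp add: k)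
  qed
  have optimal: "(poly p (\<theta> 0) - ratio_lambda A p) / (ratio_W A p - ratio_lambda A p)
      \<le> (\<theta> 0 - s) * (\<theta> 0 - r) / (\<Delta> + s * r)"
    if p: "degree p \<le> 2" and gap: "poly p (\<theta> 0) > ratio_lambda A p" for p
  proof -
    define m where "m = ratio_lambda A p"
    have "{..<n} \<noteq> {}" using e_image by auto
    then have "pverts G \<noteq> {}" using enum by (auto simp: bij_betw_def)
    then obtain x where "x \<in> pverts G" "out_degree (with_proj G) x = max_degree G"
      by (rule max_degree_attained[OF fin])
    then obtain a where a: "a < n" "out_degree (with_proj G) (v a) = max_degree G"
      using bij_betw_imp_surj_on[OF enum] by (metis imageE lessThan_iff)
    have "poly_mat p A $$ (a,a) \<le> ratio_W A p"
      unfolding ratio_W_def using a A by (auto intro!: Max_ge)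
    then have W: "coeff p 2 * \<Delta> + coeff p 0 \<le> ratio_W A p"
      using a by (simp add: poly_mat_diag_degree_le_2[OF A _ p] diag_A diag_AA \<Delta>_def)
    note poly = poly_degree_le_2[OF p]
    \<comment> \<open>Both \<open>r\<close> and \<open>s\<close> lie strictly below
      \<open>\<theta> 0\<close>, so the values of \<open>p\<close> there take part in the minimum
      \<open>m\<close>.\<close>
    have "m \<le> poly p r" "m \<le> poly p s"
      using lambda_le[of "i - 1" p] lambda_le[of i p] i rt sr by (auto simp: m_def r_def s_def)
    \<comment> \<open>The quadrature is applied to \<open>p - m\<close>, which is nonnegative at
      \<open>r\<close> and \<open>s\<close>; only the constant coefficient changes.\<close>
    then have "(\<Delta> + s * r) * (coeff p 2 * (\<theta> 0)\<^sup>2 + coeff p 1 * \<theta> 0 + (coeff p 0 - m))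
      \<le> (\<theta> 0 - s) * (\<theta> 0 - r) * (coeff p 2 * \<Delta> + (coeff p 0 - m))"
      by (intro three_point_quadrature sr rt tr ts) (auto simp: poly)
    also have "\<dots> \<le> (\<theta> 0 - s) * (\<theta> 0 - r) * (ratio_W A p - m)"
      using W sr rt by (intro mult_left_mono) auto
    finally have *: "(\<Delta> + s * r) * (poly p (\<theta> 0) - m) \<le> (\<theta> 0 - s) * (\<theta> 0 - r) * (ratio_W A p - m)"
      by (simp add: poly algebra_simps)
    \<comment> \<open>The strict gap at \<open>\<theta> 0\<close> forces
      \<open>ratio_W A p - m\<close> to be positive, so that dividing by it preserves the
      inequality.\<close>
    have "0 < (\<Delta> + s * r) * (poly p (\<theta> 0) - m)" using D gap by (simp add: m_def)
    with * have "0 < (\<theta> 0 - s) * (\<theta> 0 - r) * (ratio_W A p - m)" by linarith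
    moreover have "(\<theta> 0 - s) * (\<theta> 0 - r) > 0" using sr rt by simp
    ultimately have "ratio_W A p - m > 0" by (simp add: zero_less_mult_iff)
    with * D show ?thesis
      unfolding m_def[symmetric] by (simp add: divide_le_eq pos_le_divide_eq mult_ac)
  qed
  show ?thesis using chi optimal unfolding top s_def r_def by blast
qed

end
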